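(* Let $A \subseteq \mathcal{N}$ be open, let $x_0\in A$, and let $f : A \rightarrow \mathcal{N}$ be WLUD$^{\infty}$ at $x_0$. For each $k\in\mathbb{N}$, let $\delta_k>0$ in $\mathcal{N}$ correspond to $\epsilon=1$ in the definition of WLUD$^k$ at $x_0$; that is, $(x_0-\delta_k,x_0+\delta_k)\subset\Omega_k$ for a neighborhood $\Omega_k$ of $x_0$ in $A$ on which $f$ is $k$ times differentiable, and $$\left|f(y) - \sum_{j=0}^k \frac{f^{(j)}(x)}{j!}(y-x)^j\right|\le \left|y-x\right|^k \quad\text{for all } x,y\in (x_0-\delta_k,x_0+\delta_k).$$ Assume that $$\limsup_{j\rightarrow\infty}\left(\frac{-\lambda\left(f^{(j)}(x_0)\right)}{j}\right)<\infty \quad\text{ and }\quad \limsup_{k\rightarrow\infty}\lambda\left(\delta_k\right)<\infty.$$ Then there exists a neighborhood $U$ of $x_0$ in $A$ such that, for any $x,y \in U$, we have that $$f(y)=\sum_{j=0}^{\infty} \frac{f^{(j)}\left(x\right)}{j!}\left(y-x\right)^{j}.$$ That is, the Taylor series $\sum_{j=0}^{\infty} \frac{f^{(j)}(x)}{j!}(y-x)^{j}$ converges in $\mathcal{N}$ to $f(y)$; and hence $f$ is analytic in $U$ (i.e. $f$ has a convergent Taylor series, with sum $f$, at any point of $U$).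
   Context: Throughout, $\mathcal{N}$ is a non-Archimedean ordered field extension of $\mathbb{R}$ that is real closed and Cauchy complete in the order topology, and whose Hahn group $S_{\mathcal{N}}$ is Archimedean, i.e. isomorphic to a subgroup of $(\mathbb{R},+,<)$. Here $|x|=\max\{x,-x\}$ is the ordinary absolute value on $\mathcal{N}$. The Hahn group $S_{\mathcal{N}}$ is the set of equivalence classes of nonzero elements of $\mathcal{N}$ under the relation $x\sim y$ iff there exist $n,m\in\mathbb{N}$ with $n|x|>|y|$ and $m|y|>|x|$. It carries the addition $[x]+[y]=[xy]$ and the order $[x]<[y]$ iff $|y|\ll|x|$, where $|y|\ll|x|$ means $n|y|<|x|$ for all $n\in\mathbb{N}$. We regard $S_{\mathcal{N}}$ as a subgroup of $\mathbb{R}$. Elements of $\mathcal{N}$ can be written as generalized power series (Hahn series) $x=\sum_{q\in S_{\mathcal{N}}}a_q d^q$ with $a_q\in\mathbb{R}$, $d$ a positive infinitely small element of $\mathcal{N}$, and $\mathrm{supp}(x)=\{q: a_q\neq 0\}$ a well-ordered subset of $S_{\mathcal{N}}$; one has $x>0$ iff $x\ne 0$ and the coefficient $a_{\min \mathrm{supp}(x)}$ is positive. For $x\neq0$, $\lambda(x)=\min(\mathrm{supp}(x))$, and $\lambda(0)=\infty$. Thus $\lambda$ is the natural (order) valuation of $\mathcal{N}$, taking values in $S_{\mathcal{N}}\cup\{\infty\}\subset\mathbb{R}\cup\{\infty\}$ ($\lambda(x)$ corresponds to the class $[x]$ for $x\ne 0$), and the valuation topology coincides with the order topology. All limits, derivatives,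 and sums of series in $\mathcal{N}$ are taken in the order topology. Let $A\subseteq\mathcal{N}$ be open, $f:A\to\mathcal{N}$, $x_0\in A$ and $k\in\mathbb{N}$. The function $f$ is WLUD$^k$ ($k$ times weakly locally uniformly differentiable) at $x_0$ if $f$ is $k$ times differentiable in a neighborhood $\Omega$ of $x_0$ in $A$ and if for every $\epsilon>0$ in $\mathcal{N}$ there exists $\delta>0$ in $\mathcal{N}$ such that $(x_0-\delta,x_0+\delta)\subset\Omega$, and for every $x,y\in(x_0-\delta,x_0+\delta)$ we have $$\left|f(y) - \sum_{j=0}^k \frac{f^{(j)}(x)}{j!}(y-x)^j\right|\le \epsilon \left|y-x\right|^k.$$ The function $f$ is WLUD$^\infty$ at $x_0$ if $f$ is WLUD$^k$ at $x_0$ for every $k\in\mathbb{N}$. *)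

theory Defs
  imports Complex_Main "HOL-Library.Extended_Real" "HOL-Computational_Algebra.Polynomial"
begin

section \<open>The Hahn group of an ordered field\<close>

definition hahn_rel :: "('a::linordered_field \<times> 'a) set" where
  "hahn_rel = {(x, y). x \<noteq> 0 \<and> y \<noteq> 0 \<and>
     (\<exists>n m :: nat. of_nat n * \<bar>x\<bar> > \<bar>y\<bar> \<and> of_nat m * \<bar>y\<bar> > \<bar>x\<bar>)}"

definition hahn_class :: "'a::linordered_field \<Rightarrow> 'a set" where
  "hahn_class x = hahn_rel `` {x}"

definition hahn_group :: "'a::linordered_field set set" where
  "hahn_group = (UNIV - {0}) // hahn_rel"

definition much_less :: "'a::linordered_field \<Rightarrow> 'a \<Rightarrow> bool" where
  "much_less y x \<longleftrightarrow> (\<forall>n::nat. of_nat n * \<bar>y\<bar> < \<bar>x\<bar>)"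

text \<open>
  The order on the Hahn group is reversed with respect to magnitude: the smaller an element,
  the larger its class.  An embedding of the group into the reals is what identifies it with a
  subgroup of the reals; its range is automatically a subgroup.
\<close>

definition hahn_embedding :: "('a::linordered_field set \<Rightarrow> real) \<Rightarrow> bool" where
  "hahn_embedding \<iota> \<longleftrightarrow>
     inj_on \<iota> hahn_group \<and>
     (\<forall>x y. x \<noteq> 0 \<and> y \<noteq> 0 \<longrightarrow>
        \<iota> (hahn_class (x * y)) = \<iota> (hahn_class x) + \<iota> (hahn_class y)) \<and>
     (\<forall>x y. x \<noteq> 0 \<and> y \<noteq> 0 \<longrightarrow>
        (\<iota> (hahn_class x) < \<iota> (hahn_class y) \<longleftrightarrow> much_less y x))"

definition valuation :: "('a::linordered_field set \<Rightarrow> real) \<Rightarrow> 'a \<Rightarrow> ereal" where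
  "valuation \<iota> x = (if x = 0 then \<infinity> else ereal (\<iota> (hahn_class x)))"

section \<open>The field\<close>

definition order_Cauchy :: "(nat \<Rightarrow> 'a::linordered_field) \<Rightarrow> bool" where
  "order_Cauchy X \<longleftrightarrow> (\<forall>\<epsilon>>0. \<exists>M. \<forall>m\<ge>M. \<forall>n\<ge>M. \<bar>X m - X n\<bar> < \<epsilon>)"

text \<open>
  The class \<open>real_algebra_1\<close> makes the field an extension of the reals through \<open>of_real\<close>, which
  preserves the order because it maps squares to squares; \<open>linorder_topology\<close> says that the
  topology is the order topology.  Completeness can be stated with sequences, because an
  order topology with a nontrivial Archimedean Hahn group is first countable.
\<close>

locale nonarch_field =
  fixes \<iota> :: "'a::{linordered_field, real_algebra_1, linorder_topology} set \<Rightarrow> real"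
  assumes non_archimedean: "\<exists>x::'a. \<forall>n::nat. of_nat n < x"
    and real_closed_sqrt: "\<And>x::'a. 0 < x \<Longrightarrow> \<exists>y. y ^ 2 = x"
    and real_closed_odd: "\<And>p::'a poly. odd (degree p) \<Longrightarrow> \<exists>x. poly p x = 0"
    and Cauchy_complete: "\<And>X::nat \<Rightarrow> 'a. order_Cauchy X \<Longrightarrow> convergent X"
    and Hahn_group_in_reals: "hahn_embedding \<iota>"

section \<open>Differentiation in the order topology\<close>

text \<open>
  The library derivatives require a real normed field, which a non-Archimedean field is not.
  Functions are total; all derivatives are taken at points of an open set, so values outside
  that set play no role.
\<close>

definition has_deriv_at ::
  "('a::{linordered_field, linorder_topology} \<Rightarrow> 'a) \<Rightarrow> 'a \<Rightarrow> 'a \<Rightarrow> bool" where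
  "has_deriv_at f D x \<longleftrightarrow> ((\<lambda>y. (f y - f x) / (y - x)) \<longlongrightarrow> D) (at x)"

definition deriv_fun ::
  "('a::{linordered_field, linorder_topology} \<Rightarrow> 'a) \<Rightarrow> 'a \<Rightarrow> 'a" where
  "deriv_fun f x = (THE D. has_deriv_at f D x)"

definition nderiv ::
  "nat \<Rightarrow> ('a::{linordered_field, linorder_topology} \<Rightarrow> 'a) \<Rightarrow> 'a \<Rightarrow> 'a" where
  "nderiv j f = (deriv_fun ^^ j) f"

text \<open>To be used for open \<open>S\<close> only.\<close>

definition times_differentiable_on ::
  "nat \<Rightarrow> ('a::{linordered_field, linorder_topology} \<Rightarrow> 'a) \<Rightarrow> 'a set \<Rightarrow> bool" where
  "times_differentiable_on k f S \<longleftrightarrow>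
     (\<forall>j<k. \<forall>x\<in>S. \<exists>D. has_deriv_at (nderiv j f) D x)"

definition taylor_bound ::
  "nat \<Rightarrow> ('a::{linordered_field, linorder_topology} \<Rightarrow> 'a) \<Rightarrow> 'a \<Rightarrow> 'a set \<Rightarrow> bool" where
  "taylor_bound k f \<epsilon> I \<longleftrightarrow>
     (\<forall>x\<in>I. \<forall>y\<in>I.
        \<bar>f y - (\<Sum>j\<le>k. nderiv j f x / fact j * (y - x) ^ j)\<bar> \<le> \<epsilon> * \<bar>y - x\<bar> ^ k)"

definition WLUD ::
  "nat \<Rightarrow> ('a::{linordered_field, linorder_topology} \<Rightarrow> 'a) \<Rightarrow> 'a set \<Rightarrow> 'a \<Rightarrow> bool" where
  "WLUD k f A x0 \<longleftrightarrow>
     (\<exists>\<Omega>. open \<Omega> \<and> x0 \<in> \<Omega> \<and> \<Omega> \<subseteq> A \<and> times_differentiable_on k f \<Omega> \<and>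
        (\<forall>\<epsilon>>0. \<exists>\<delta>>0. {x0 - \<delta><..<x0 + \<delta>} \<subseteq> \<Omega> \<and>
           taylor_bound k f \<epsilon> {x0 - \<delta><..<x0 + \<delta>}))"

text \<open>
  The natural numbers start at 1 here.  Including 0 would not change the notion, since \<open>WLUD 1\<close>
  implies \<open>WLUD 0\<close>, which is continuity at the point.
\<close>

definition WLUD_infinity ::
  "('a::{linordered_field, linorder_topology} \<Rightarrow> 'a) \<Rightarrow> 'a set \<Rightarrow> 'a \<Rightarrow> bool" where
  "WLUD_infinity f A x0 \<longleftrightarrow> (\<forall>k\<ge>1. WLUD k f A x0)"

definition taylor_sums ::
  "('a::{linordered_field, linorder_topology} \<Rightarrow> 'a) \<Rightarrow> 'a \<Rightarrow> 'a \<Rightarrow> bool" where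
  "taylor_sums f x y \<longleftrightarrow> (\<lambda>j. nderiv j f x / fact j * (y - x) ^ j) sums f y"

definition analytic_in ::
  "('a::{linordered_field, linorder_topology} \<Rightarrow> 'a) \<Rightarrow> 'a set \<Rightarrow> bool" where
  "analytic_in f U \<longleftrightarrow>
     (\<forall>k. times_differentiable_on k f U) \<and>
     (\<forall>x\<in>U. \<exists>V. open V \<and> x \<in> V \<and> V \<subseteq> U \<and> (\<forall>y\<in>V. taylor_sums f x y))"

end

theory Submission
  imports Defs
begin

text \<open>
  Since the valuations of the radii \<open>\<delta> k\<close> are eventually bounded and the value group is
  Archimedean, some power of a positive infinitesimal \<open>h\<close> lies below \<open>\<delta> k\<close> for all large \<open>k\<close>
  (\<open>eventually_power_below_radii\<close>).  On one fixed interval around \<open>x0\<close>, of length at most \<open>h\<close>,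
  every large \<open>k\<close> therefore gives the same kind of estimate: the Taylor polynomial of degree \<open>k\<close>
  at \<open>x\<close> misses \<open>f y\<close> by at most \<open>\<bar>y - x\<bar> ^ k \<le> h ^ k\<close>.

  Powers of an infinitesimal tend to \<open>0\<close> in the order topology (\<open>eventually_power_less\<close>),
  again because the value group is Archimedean.  So the remainder vanishes in the limit and the
  Taylor series at \<open>x\<close> sums to \<open>f y\<close> (\<open>taylor_sums_if_taylor_bounds\<close>).
\<close>

context nonarch_field
begin

text \<open>
  The reciprocal \<open>h\<close> of an infinitely large element is much less than \<open>1\<close>, whose valuation is
  \<open>0\<close> by additivity.
\<close>

lemma exists_infinitesimal:
  obtains h :: 'a where "0 < h" "0 < \<iota> (hahn_class h)"
proof -
  obtain w :: 'a where w: "\<And>n::nat. of_nat n < w"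
    using non_archimedean by blast
  have w0: "0 < w" using w[of 0] by simp
  define h where "h = inverse w"
  have h0: "0 < h" using w0 by (simp add: h_def)
  have "of_nat n * h < 1" for n
    using w[of n] w0 by (simp add: h_def field_simps)
  hence "much_less h 1"
    using h0 by (simp add: much_less_def)
  hence "\<iota> (hahn_class 1) < \<iota> (hahn_class h)"
    using Hahn_group_in_reals h0 unfolding hahn_embedding_def
    by (metis less_irrefl zero_neq_one)
  moreover have "\<iota> (hahn_class (1 * 1 :: 'a)) = \<iota> (hahn_class (1::'a)) + \<iota> (hahn_class (1::'a))"
    using Hahn_group_in_reals unfolding hahn_embedding_def by (metis zero_neq_one)
  ultimately show thesis using that[OF h0] by simp
qed

lemma hahn_class_power:
  assumes "h \<noteq> (0::'a)"
  shows "\<iota> (hahn_class (h ^ Suc n)) = real (Suc n) * \<iota> (hahn_class h)"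
proof (induction n)
  case (Suc n)
  have "\<iota> (hahn_class (h * h ^ Suc n)) = \<iota> (hahn_class h) + \<iota> (hahn_class (h ^ Suc n))"
    using Hahn_group_in_reals assms unfolding hahn_embedding_def
    by (metis power_not_zero)
  with Suc show ?case by (simp add: algebra_simps)
qed simp

lemma less_if_valuation_greater:
  assumes "0 < x" "0 < y" "\<iota> (hahn_class x) < \<iota> (hahn_class (y::'a))"
  shows "y < x"
proof -
  have "much_less y x"
    using Hahn_group_in_reals assms unfolding hahn_embedding_def by (metis less_irrefl)
  hence "of_nat 1 * \<bar>y\<bar> < \<bar>x\<bar>" unfolding much_less_def by blast
  with assms show ?thesis by simp
qed

text \<open>
  Values lie in the Archimedean group of the reals.  In a larger value group all powers of a
  positive infinitesimal could stay above one fixed positive element.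
\<close>

lemma eventually_power_valuation_greater:
  assumes "0 < h" "0 < \<iota> (hahn_class (h::'a))"
  shows "\<exists>N. \<forall>n\<ge>N. t < \<iota> (hahn_class (h ^ Suc n))"
proof -
  obtain N :: nat where N: "t < real N * \<iota> (hahn_class h)"
    using reals_Archimedean3[OF assms(2)] by blast
  have "t < \<iota> (hahn_class (h ^ Suc n))" if "n \<ge> N" for n
  proof -
    have "real N * \<iota> (hahn_class h) \<le> real (Suc n) * \<iota> (hahn_class h)"
      using that assms(2) by (intro mult_right_mono) auto
    with N have "t < real (Suc n) * \<iota> (hahn_class h)" by linarith
    thus ?thesis using hahn_class_power assms(1) by (metis less_irrefl)
  qed
  thus ?thesis by blast
qed

lemma eventually_power_less:
  assumes "0 < h" "0 < \<iota> (hahn_class h)" "0 < (e::'a)"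
  shows "\<forall>\<^sub>F k in sequentially. h ^ k < e"
proof -
  obtain N where N: "\<And>n. n \<ge> N \<Longrightarrow> \<iota> (hahn_class e) < \<iota> (hahn_class (h ^ Suc n))"
    using eventually_power_valuation_greater[OF assms(1,2)] by blast
  have "h ^ k < e" if k: "k \<ge> Suc N" for k
  proof -
    obtain n where "k = Suc n" "n \<ge> N" using k by (cases k) auto
    with N[of n] show ?thesis using less_if_valuation_greater[of e "h ^ k"] assms by simp
  qed
  thus ?thesis by (auto simp: eventually_sequentially)
qed

text \<open>
  The radius \<open>h\<close> enters twice: \<open>\<bar>y - x\<bar> \<le> h\<close> turns the bounds into \<open>h ^ k\<close>, and the
  positive valuation of \<open>h\<close> makes these bounds tend to \<open>0\<close>.
\<close>

lemma taylor_sums_if_taylor_bounds: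
  assumes h: "0 < h" "0 < \<iota> (hahn_class h)"
    and bound: "\<And>k. k \<ge> K \<Longrightarrow> taylor_bound k f 1 I"
    and xy: "x \<in> I" "y \<in> I" "\<bar>y - x\<bar> \<le> (h::'a)"
  shows "taylor_sums f x y"
proof -
  let ?T = "\<lambda>k. \<Sum>j\<le>k. nderiv j f x / fact j * (y - x) ^ j"
  have remainder: "\<bar>f y - ?T k\<bar> \<le> h ^ k" if "k \<ge> K" for k
  proof -
    have "\<bar>f y - ?T k\<bar> \<le> \<bar>y - x\<bar> ^ k"
      using bound[OF that] xy unfolding taylor_bound_def by auto
    also have "\<dots> \<le> h ^ k" using xy by (intro power_mono) auto
    finally show ?thesis .
  qed
  have close: "\<forall>\<^sub>F k in sequentially. \<bar>f y - ?T k\<bar> < e" if "0 < e" for e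
    using eventually_power_less[OF h that] eventually_ge_at_top[of K]
    by eventually_elim (use remainder le_less_trans in blast)
  have "?T \<longlonglongrightarrow> f y"
  proof (rule order_tendstoI)
    fix a assume "a < f y"
    hence "\<forall>\<^sub>F k in sequentially. \<bar>f y - ?T k\<bar> < f y - a" by (intro close) simp
    thus "\<forall>\<^sub>F k in sequentially. a < ?T k" by eventually_elim auto
  next
    fix a assume "f y < a"
    hence "\<forall>\<^sub>F k in sequentially. \<bar>f y - ?T k\<bar> < a - f y" by (intro close) simp
    thus "\<forall>\<^sub>F k in sequentially. ?T k < a" by eventually_elim auto
  qed
  thus ?thesis unfolding taylor_sums_def sums_def_le .
qed

text \<open>
  A finite limit superior of the valuations is a lower bound, in magnitude, for almost all radii:
  any \<open>h ^ Suc n\<close> of larger valuation is infinitely smaller than each of them.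
\<close>

lemma eventually_power_below_radii:
  assumes h: "0 < h" "0 < \<iota> (hahn_class (h::'a))"
    and pos: "\<And>k. k \<ge> 1 \<Longrightarrow> 0 < \<delta> k"
    and bounded: "limsup (\<lambda>k. valuation \<iota> (\<delta> k)) < \<infinity>"
  shows "\<exists>n K. 1 \<le> K \<and> (\<forall>k\<ge>K. h ^ Suc n < \<delta> k)"
proof -
  obtain t where t: "limsup (\<lambda>k. valuation \<iota> (\<delta> k)) < ereal t"
    using bounded less_PInf_Ex_of_nat[of "limsup (\<lambda>k. valuation \<iota> (\<delta> k))"] by auto
  hence "\<forall>\<^sub>F k in sequentially. valuation \<iota> (\<delta> k) < ereal t"
    by (rule Limsup_lessD)
  then obtain K0 where K0: "\<And>k. k \<ge> K0 \<Longrightarrow> valuation \<iota> (\<delta> k) < ereal t"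
    by (auto simp: eventually_sequentially)
  obtain n where n: "t < \<iota> (hahn_class (h ^ Suc n))"
    using eventually_power_valuation_greater[OF h] by blast
  have "h ^ Suc n < \<delta> k" if k: "k \<ge> max 1 K0" for k
  proof -
    have pk: "0 < \<delta> k" using k pos by simp
    hence "\<iota> (hahn_class (\<delta> k)) < t"
      using K0[of k] k by (auto simp: valuation_def)
    hence "\<iota> (hahn_class (\<delta> k)) < \<iota> (hahn_class (h ^ Suc n))"
      using n by linarith
    with pk zero_less_power[OF h(1)] show ?thesis by (rule less_if_valuation_greater)
  qed
  thus ?thesis by (intro exI[of _ n] exI[of _ "max 1 K0"]) simp
qed

end

lemma times_differentiable_on_antimono:
  assumes "times_differentiable_on k f S" "j \<le> k" "T \<subseteq> S"
  shows "times_differentiable_on j f T"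
  using assms unfolding times_differentiable_on_def by (meson order_less_le_trans subsetD)

lemma taylor_bound_subset:
  assumes "taylor_bound k f \<epsilon> I" "J \<subseteq> I"
  shows "taylor_bound k f \<epsilon> J"
  using assms unfolding taylor_bound_def by blast

theorem theorem8:
  fixes \<iota> :: "'a::{linordered_field, real_algebra_1, linorder_topology} set \<Rightarrow> real"
    and A :: "'a set" and x0 :: 'a and f :: "'a \<Rightarrow> 'a" and \<delta> :: "nat \<Rightarrow> 'a"
  assumes "nonarch_field \<iota>"
    and "open A" and "x0 \<in> A"
    and "WLUD_infinity f A x0"
    and "\<And>k. k \<ge> 1 \<Longrightarrow> \<delta> k > 0 \<and>
           (\<exists>\<Omega>. open \<Omega> \<and> x0 \<in> \<Omega> \<and> \<Omega> \<subseteq> A \<and> times_differentiable_on k f \<Omega> \<and>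
              {x0 - \<delta> k<..<x0 + \<delta> k} \<subseteq> \<Omega>) \<and>
           taylor_bound k f 1 {x0 - \<delta> k<..<x0 + \<delta> k}"
    and "limsup (\<lambda>j. - valuation \<iota> (nderiv j f x0) / ereal (real j)) < \<infinity>"
    and "limsup (\<lambda>k. valuation \<iota> (\<delta> k)) < \<infinity>"
  shows "\<exists>U. open U \<and> x0 \<in> U \<and> U \<subseteq> A \<and>
           (\<forall>k. times_differentiable_on k f U) \<and>
           (\<forall>x\<in>U. \<forall>y\<in>U. taylor_sums f x y) \<and>
           analytic_in f U"
proof -
  interpret nonarch_field \<iota> by fact
  obtain h :: 'a where h: "0 < h" "0 < \<iota> (hahn_class h)"
    using exists_infinitesimal by blast
  obtain n K where K: "1 \<le> K" and below: "\<And>k. k \<ge> K \<Longrightarrow> h ^ Suc n < \<delta> k"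
    using eventually_power_below_radii[OF h, of \<delta>] assms(5,7) by blast
  \<comment> \<open>Capping by \<open>h\<close> and halving makes all differences of points of \<open>U\<close> at most \<open>h\<close>.\<close>
  define r where "r = min h (h ^ Suc n) / 2"
  define U where "U = {x0 - r<..<x0 + r}"
  have r: "0 < r" using h by (simp add: r_def)
  have diam: "\<bar>y - x\<bar> \<le> h" if "x \<in> U" "y \<in> U" for x y
  proof -
    have "\<bar>y - x\<bar> < 2 * r" using that by (auto simp: U_def abs_less_iff)
    also have "\<dots> \<le> h" by (simp add: r_def)
    finally show ?thesis by simp
  qed
  have sub: "U \<subseteq> {x0 - \<delta> k<..<x0 + \<delta> k}" if "k \<ge> K" for k
  proof -
    have "2 * r < \<delta> k" using below[OF that] by (simp add: r_def)
    hence "r < \<delta> k" using r by linarith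
    thus ?thesis by (auto simp: U_def)
  qed
  have diff_and_sub: "times_differentiable_on k f U \<and> U \<subseteq> A" if kK: "k \<ge> K" for k
  proof -
    obtain \<Omega> where "\<Omega> \<subseteq> A" "times_differentiable_on k f \<Omega>"
        "{x0 - \<delta> k<..<x0 + \<delta> k} \<subseteq> \<Omega>"
      using assms(5)[OF order_trans[OF K kK]] by blast
    thus ?thesis using sub[OF kK] times_differentiable_on_antimono[of k f \<Omega> k U] by blast
  qed
  have diff: "times_differentiable_on k f U" for k
    using diff_and_sub[of "max k K"] times_differentiable_on_antimono[of "max k K" f U k U]
    by simp
  have "taylor_bound k f 1 U" if "k \<ge> K" for k
    using assms(5)[OF order_trans[OF K that]] taylor_bound_subset[OF _ sub[OF that]] by blast
  hence sums: "taylor_sums f x y" if "x \<in> U" "y \<in> U" for x y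
    using taylor_sums_if_taylor_bounds[OF h] diam that by blast
  have U: "open U" "x0 \<in> U" "U \<subseteq> A"
    using r diff_and_sub[of K] by (auto simp: U_def)
  moreover have "analytic_in f U"
    unfolding analytic_in_def using diff sums U(1) by blast
  ultimately show ?thesis using diff sums by blast
qed

end
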